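(* Let $E^1,E^2\subset\mathbb{R}^n$ be two linear subspaces such that $E^1\oplus E^2=\mathbb{R}^n$. Let $p_i:E^i\to\mathbb{R}^n$, $i=1,2$, be two proper embeddings at a bounded distance from the inclusion, i.e. $\sup_{z\in E^i}\|p_i(z)-z\|<\infty$. Put $W_i=p_i(E^i)$, $i=1,2$. Then $W_1\cap W_2\ne\emptyset$. *)

theory Defs
  imports "HOL-Analysis.Analysis"
begin

(* Internal direct sum E \<oplus> F = UNIV. *)
definition complementary_subspaces :: "'a::real_vector set \<Rightarrow> 'a set \<Rightarrow> bool"
  where "complementary_subspaces E F \<longleftrightarrow>
    subspace E \<and> subspace F \<and> {x + y |x y. x \<in> E \<and> y \<in> F} = UNIV \<and> E \<inter> F = {0}"

(* "Embedding" is topological: no smoothness is required.  Only the values of p on E matter.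
   For maps between locally compact Hausdorff spaces, proper_map (closed, with compact fibres)
   means, for continuous p, that preimages of compact sets are compact. *)
definition proper_embedding_on :: "'a::topological_space set \<Rightarrow> ('a \<Rightarrow> 'b::topological_space) \<Rightarrow> bool"
  where "proper_embedding_on E p \<longleftrightarrow>
    embedding_map (top_of_set E) euclidean p \<and> proper_map (top_of_set E) euclidean p"

end

theory Submission
  imports Defs
begin

text \<open>
  Write \<open>\<pi>\<^sub>1\<close> and \<open>\<pi>\<^sub>2\<close> for the projections of the direct sum.  Every point is the difference
  \<open>z = \<pi>\<^sub>1 z - (- \<pi>\<^sub>2 z)\<close> of a point of \<open>E1\<close> and a point of \<open>E2\<close>, so the map
  \<open>G z = p1 (\<pi>\<^sub>1 z) - p2 (- \<pi>\<^sub>2 z)\<close> is continuous and stays at bounded distance from the identity.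
  By Brouwer's theorem such a map has a zero, and a zero of \<open>G\<close> is exactly a point \<open>a\<close> of \<open>E1\<close>
  together with a point \<open>b\<close> of \<open>E2\<close> such that \<open>p1 a = p2 b\<close>.
\<close>

text \<open>
  Choose any decomposition for each point; a decomposition is unique because \<open>E \<inter> F = {0}\<close>, and
  uniqueness makes the choice linear.
\<close>

lemma complementary_subspaces_projection:
  fixes E F :: "'a::real_vector set"
  assumes "complementary_subspaces E F"
  obtains P where "linear P" "\<And>z. P z \<in> E" "\<And>z. z - P z \<in> F"
proof -
  have E: "subspace E" and F: "subspace F" and sum: "{x + y |x y. x \<in> E \<and> y \<in> F} = UNIV"
    and int: "E \<inter> F = {0}"
    using assms by (auto simp: complementary_subspaces_def)
  have "\<exists>x. x \<in> E \<and> z - x \<in> F" for z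
  proof -
    have "z \<in> {x + y |x y. x \<in> E \<and> y \<in> F}"
      using sum by simp
    then show ?thesis by force
  qed
  then obtain P where PE: "\<And>z. P z \<in> E" and PF: "\<And>z. z - P z \<in> F"
    by metis
  have uniq: "P z = x" if "x \<in> E" "z - x \<in> F" for x z
  proof -
    have "P z - x \<in> E"
      using E PE that(1) by (rule subspace_diff)
    moreover have "(z - x) - (z - P z) \<in> F"
      using F that(2) PF by (rule subspace_diff)
    ultimately have "P z - x \<in> E \<inter> F" by simp
    then show ?thesis using int by simp
  qed
  have "linear P"
  proof (rule linearI)
    fix x y
    have "(x - P x) + (y - P y) \<in> F"
      using F PF PF by (rule subspace_add)
    then show "P (x + y) = P x + P y"
      by (intro uniq subspace_add[OF E] PE) (simp add: algebra_simps)
  next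
    fix c x
    have "c *\<^sub>R (x - P x) \<in> F"
      using F PF by (rule subspace_scale)
    then show "P (c *\<^sub>R x) = c *\<^sub>R P x"
      by (intro uniq subspace_scale[OF E] PE) (simp add: algebra_simps)
  qed
  then show thesis using PE PF by (rule that)
qed

text \<open>
  A zero of \<open>G\<close> is a fixed point of \<open>z - G z\<close>, and this map sends the whole space into one ball.
\<close>

lemma bounded_distance_from_identity_has_zero:
  fixes G :: "'a::euclidean_space \<Rightarrow> 'a"
  assumes cont: "continuous_on UNIV G" and bound: "\<And>z. norm (z - G z) \<le> C"
  obtains z where "G z = 0"
proof -
  \<comment> \<open>Brouwer's theorem asks for a ball of positive radius, and \<open>C\<close> may be zero.\<close>
  have "0 < C + 1"
    using norm_ge_zero[of "0 - G 0"] bound[of 0] by linarith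
  moreover have "continuous_on (cball 0 (C + 1)) (\<lambda>z. z - G z)"
    by (intro continuous_intros continuous_on_subset[OF cont]) auto
  moreover have "(\<lambda>z. z - G z) \<in> cball 0 (C + 1) \<rightarrow> cball 0 (C + 1)"
  proof
    fix z show "z - G z \<in> cball 0 (C + 1)"
      using bound[of z] by simp
  qed
  ultimately obtain z where "z - G z = z"
    by (rule brouwer_ball)
  then show thesis by (intro that[of z]) simp
qed

lemma images_of_complementary_subspaces_meet:
  fixes E F :: "'a::euclidean_space set" and p q :: "'a \<Rightarrow> 'a"
  assumes compl: "complementary_subspaces E F"
    and contp: "continuous_on E p" and contq: "continuous_on F q"
    and boundp: "\<And>z. z \<in> E \<Longrightarrow> norm (p z - z) \<le> A"
    and boundq: "\<And>z. z \<in> F \<Longrightarrow> norm (q z - z) \<le> B"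
  shows "p ` E \<inter> q ` F \<noteq> {}"
proof -
  obtain P where "linear P" and PE: "\<And>z. P z \<in> E" and PF: "\<And>z. z - P z \<in> F"
    using complementary_subspaces_projection[OF compl] by blast
  have contP: "continuous_on S P" for S
    using \<open>linear P\<close> by (simp add: linear_continuous_on linear_conv_bounded_linear)
  have QF: "P z - z \<in> F" for z
  proof -
    have "subspace F"
      using compl by (simp add: complementary_subspaces_def)
    then show ?thesis
      using subspace_neg[OF _ PF, of z] by simp
  qed
  define G where "G = (\<lambda>z. p (P z) - q (P z - z))"
  have "continuous_on UNIV G"
    unfolding G_def
    by (intro continuous_intros continuous_on_compose2[OF contp] continuous_on_compose2[OF contq] contP)
       (auto simp: PE QF)
  moreover have "norm (z - G z) \<le> A + B" for z
  proof -
    have "z - G z = (q (P z - z) - (P z - z)) - (p (P z) - P z)"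
      by (simp add: G_def)
    also have "norm \<dots> \<le> norm (q (P z - z) - (P z - z)) + norm (p (P z) - P z)"
      by (rule norm_triangle_ineq4)
    also have "\<dots> \<le> B + A"
      by (intro add_mono boundp boundq PE QF)
    finally show ?thesis by simp
  qed
  ultimately obtain z where "G z = 0"
    by (rule bounded_distance_from_identity_has_zero)
  then have "p (P z) = q (P z - z)"
    by (simp add: G_def)
  then show ?thesis using PE[of z] QF[of z] by blast
qed

lemma proper_embedding_on_imp_continuous_on:
  "proper_embedding_on E p \<Longrightarrow> continuous_on E p"
  unfolding proper_embedding_on_def embedding_map_def
  by (blast dest: homeomorphic_imp_continuous_map continuous_map_into_fulltopology
      intro: continuous_map_iff_continuous[THEN iffD1])

theorem lemma7p4:
  fixes E1 E2 W1 W2 :: "(real ^ 'n) set"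
    and p1 p2 :: "real ^ 'n \<Rightarrow> real ^ 'n"
  assumes "complementary_subspaces E1 E2"
    and "proper_embedding_on E1 p1"
    and "proper_embedding_on E2 p2"
    and "bdd_above ((\<lambda>z. norm (p1 z - z)) ` E1)"
    and "bdd_above ((\<lambda>z. norm (p2 z - z)) ` E2)"
    and "W1 = p1 ` E1"
    and "W2 = p2 ` E2"
  shows "W1 \<inter> W2 \<noteq> {}"
proof -
  obtain A where A: "\<And>z. z \<in> E1 \<Longrightarrow> norm (p1 z - z) \<le> A"
    using assms(4) by (auto simp: bdd_above_def)
  obtain B where B: "\<And>z. z \<in> E2 \<Longrightarrow> norm (p2 z - z) \<le> B"
    using assms(5) by (auto simp: bdd_above_def)
  show ?thesis
    unfolding assms(6,7)
    by (rule images_of_complementary_subspaces_meet[OF assms(1)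
          assms(2,3)[THEN proper_embedding_on_imp_continuous_on] A B])
qed

end
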